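(* Let $r>0$, let $\mathbb{R}^2_1$ be $\mathbb{R}^2$ with canonical basis $(\mathbf{e}_0,\mathbf{e}_1)$ and metric $\mathrm{diag}(-1,1)$, let $\mathbf{e}_+=\frac{1}{\sqrt2}(\mathbf{e}_0+\mathbf{e}_1)$, and let $\mathsf{lat}=\{k\,r\,\mathbf{e}_+\mid k\in\mathbb{Z}\}$. Let $eG_{\mathsf{lat}}=\{\Lambda\in O(1,1)\mid \Lambda\,\mathsf{lat}\subset\mathsf{lat}\}$. Then, expressed in the lightlike coordinates $(x^+,x^-)$, $eG_{\mathsf{lat}}$ is exactly the set of matrices $$\Lambda_m=\begin{pmatrix} m & 0\\ 0 & \frac1m\end{pmatrix},\qquad m\in\mathbb{Z}\setminus\{0\}.$$ It is a semigroup with composition $\Lambda_m\Lambda_{m'}=\Lambda_{mm'}$ and unit element $\Lambda_1$, isomorphic to the set of nonzero integers with multiplication as composition and $1$ as unit element.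
   Context: $O(1,1)$ is the full group of linear transformations of $\mathbb{R}^2$ preserving the metric $\mathrm{diag}(-1,1)$. If $(x^0,x^1)$ are the coordinates with respect to $(\mathbf{e}_0,\mathbf{e}_1)$, the lightlike coordinates are $x^+=\frac{1}{\sqrt2}(x^0+x^1)$, $x^-=\frac{1}{\sqrt2}(x^0-x^1)$, so that $\mathbf{e}_+$ is the basis vector in the $x^+$-direction. In these coordinates the metric has matrix $\begin{pmatrix}0&-1\\-1&0\end{pmatrix}$. The inclusion $\Lambda\,\mathsf{lat}\subset\mathsf{lat}$ is not required to be proper. *)

theory Defs
  imports "HOL-Analysis.Analysis" "HOL-Algebra.Group"
begin

text \<open>The coordinates \<open>(x\<^sup>0, x\<^sup>1)\<close> of a vector \<open>x\<close> are \<open>(x $ 1, x $ 2)\<close>.\<close>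

definition e0 :: "real^2" where "e0 = axis 1 1"

definition e1 :: "real^2" where "e1 = axis 2 1"

definition metric :: "real^2 \<Rightarrow> real^2 \<Rightarrow> real" where
  "metric v w = - (v $ 1 * w $ 1) + v $ 2 * w $ 2"

definition e_plus :: "real^2" where
  "e_plus = (1 / sqrt 2) *\<^sub>R (e0 + e1)"

definition O11 :: "(real^2 \<Rightarrow> real^2) set" where
  "O11 = {L. linear L \<and> (\<forall>v w. metric (L v) (L w) = metric v w)}"

definition lat :: "real \<Rightarrow> (real^2) set" where
  "lat r = {(of_int k * r) *\<^sub>R e_plus | k :: int. True}"

definition eG :: "real \<Rightarrow> (real^2 \<Rightarrow> real^2) set" where
  "eG r = {L \<in> O11. L ` lat r \<subseteq> lat r}"

definition eG_monoid :: "real \<Rightarrow> (real^2 \<Rightarrow> real^2) monoid" where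
  "eG_monoid r = \<lparr>carrier = eG r, monoid.mult = (\<circ>), one = id\<rparr>"

definition nonzero_int_monoid :: "int monoid" where
  "nonzero_int_monoid = \<lparr>carrier = {m. m \<noteq> 0}, monoid.mult = (*), one = 1\<rparr>"

text \<open>Component \<open>1\<close> is \<open>x\<^sup>+\<close> and component \<open>2\<close> is \<open>x\<^sup>-\<close>.\<close>

definition lightlike_coords :: "real^2 \<Rightarrow> real^2" where
  "lightlike_coords x =
     vector [(1 / sqrt 2) * (x $ 1 + x $ 2), (1 / sqrt 2) * (x $ 1 - x $ 2)]"

text \<open>\<open>inv_into UNIV\<close> is the inverse function; the plain notation is overloaded with the
  group-theoretic inverse.\<close>

definition lightlike_matrix :: "(real^2 \<Rightarrow> real^2) \<Rightarrow> real^2^2" where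
  "lightlike_matrix L = matrix (lightlike_coords \<circ> L \<circ> inv_into UNIV lightlike_coords)"

definition Lam :: "int \<Rightarrow> real^2^2" where
  "Lam m = vector [vector [of_int m, 0], vector [0, 1 / of_int m]]"

lemma linear_lightlike_coords: "linear lightlike_coords"
  by (rule linearI) (simp_all add: lightlike_coords_def vec_eq_iff forall_2 add_divide_distrib
    diff_divide_distrib algebra_simps)

lemma lightlike_coords_involution: "lightlike_coords (lightlike_coords x) = x"
  by (simp add: lightlike_coords_def vec_eq_iff forall_2 field_simps)

lemma bij_lightlike_coords: "bij lightlike_coords"
  by (rule o_bij[of lightlike_coords]) (simp_all add: fun_eq_iff lightlike_coords_involution)

lemma lightlike_coords_e_plus: "lightlike_coords e_plus = axis 1 1"
  by (simp add: lightlike_coords_def e_plus_def e0_def e1_def vec_eq_iff forall_2 axis_def)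

lemma metric_lightlike:
  "metric v w = - (lightlike_coords v $ 1 * lightlike_coords w $ 2)
                - lightlike_coords v $ 2 * lightlike_coords w $ 1"
  by (simp add: metric_def lightlike_coords_def field_simps)

lemma lightlike_matrix_works:
  assumes "linear L"
  shows "lightlike_coords (L x) = lightlike_matrix L *v lightlike_coords x"
proof -
  have inv: "inv_into UNIV lightlike_coords = lightlike_coords"
    by (rule inv_equality) (simp_all add: lightlike_coords_involution)
  have "linear (lightlike_coords \<circ> L \<circ> lightlike_coords)"
    by (intro linear_compose linear_lightlike_coords assms)
  then show ?thesis
    by (simp add: lightlike_matrix_def inv matrix_works lightlike_coords_involution)
qed

end

theory Submission
  imports Defs
begin

(* In lightlike coordinates the lattice vector r e_+ is an eigenvector of L with an integer
   eigenvalue k, so the first column of the matrix of L is (k, 0). Preservation of the metric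
   on the pair of lightlike basis vectors forces the lower right entry to be 1/k (in
   particular k is nonzero), and preservation on the second basis vector alone then makes the
   upper right entry vanish. *)

lemma Lam_nth [simp]:
  "Lam m $ 1 $ 1 = of_int m" "Lam m $ 1 $ 2 = 0"
  "Lam m $ 2 $ 1 = 0" "Lam m $ 2 $ 2 = 1 / of_int m"
  by (simp_all add: Lam_def)

text \<open>The index \<open>0\<close> is covered as well: division by zero yields zero, so
  \<open>Lam 0\<close> is the zero matrix.\<close>

lemma Lam_mult: "Lam m ** Lam m' = Lam (m * m')"
  by (simp add: vec_eq_iff forall_2 matrix_matrix_mult_def sum_2)

lemma Lam_1: "Lam 1 = mat 1"
  by (simp add: vec_eq_iff forall_2 mat_def)

lemma Lam_eq_iff [simp]: "Lam m = Lam m' \<longleftrightarrow> m = m'"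
proof
  assume "Lam m = Lam m'"
  then have "Lam m $ 1 $ 1 = Lam m' $ 1 $ 1"
    by simp
  then show "m = m'"
    by simp
qed simp

lemma inv_lightlike_coords: "inv_into UNIV lightlike_coords = lightlike_coords"
  by (rule inv_equality) (simp_all add: lightlike_coords_involution)

lemma lightlike_matrix_compose:
  assumes "linear L" "linear L'"
  shows "lightlike_matrix (L \<circ> L') = lightlike_matrix L ** lightlike_matrix L'"
proof -
  have "linear (lightlike_coords \<circ> K \<circ> lightlike_coords)" if "linear K" for K
    by (intro linear_compose linear_lightlike_coords that)
  \<comment> \<open>\<open>matrix_compose\<close> expects the inner map first, hence the swapped
    order; the two adjacent coordinate changes in the middle cancel by involutivity.\<close>
  from matrix_compose[OF this[OF assms(2)] this[OF assms(1)]] show ?thesis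
    by (simp add: lightlike_matrix_def inv_lightlike_coords o_def lightlike_coords_involution)
qed

lemma lightlike_matrix_id: "lightlike_matrix id = mat 1"
proof -
  have "lightlike_coords \<circ> id \<circ> lightlike_coords = id"
    by (simp add: fun_eq_iff lightlike_coords_involution)
  then show ?thesis
    by (simp add: lightlike_matrix_def inv_lightlike_coords matrix_id_mat_1 del: comp_id)
qed

text \<open>The map represented by \<open>Lam m\<close>, taken back to standard coordinates; the
  outer \<open>lightlike_coords\<close> acts as its own inverse.\<close>

definition boost :: "int \<Rightarrow> real^2 \<Rightarrow> real^2" where
  "boost m x = lightlike_coords (Lam m *v lightlike_coords x)"

lemma lightlike_coords_boost:
  "lightlike_coords (boost m x) = Lam m *v lightlike_coords x"
  by (simp add: boost_def lightlike_coords_involution)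

lemma linear_boost: "linear (boost m)"
proof -
  have "linear (lightlike_coords \<circ> (\<lambda>v. Lam m *v v) \<circ> lightlike_coords)"
    by (intro linear_compose linear_lightlike_coords matrix_vector_mul_linear)
  moreover have "boost m = lightlike_coords \<circ> (\<lambda>v. Lam m *v v) \<circ> lightlike_coords"
    by (simp add: fun_eq_iff boost_def)
  ultimately show ?thesis
    by simp
qed

lemma lightlike_matrix_boost: "lightlike_matrix (boost m) = Lam m"
proof -
  have "lightlike_coords \<circ> boost m \<circ> lightlike_coords = (\<lambda>v. Lam m *v v)"
    by (simp add: fun_eq_iff boost_def lightlike_coords_involution)
  then show ?thesis
    by (simp add: lightlike_matrix_def inv_lightlike_coords)
qed

lemma boost_mult: "boost (m * m') = boost m \<circ> boost m'"
  by (simp add: fun_eq_iff boost_def lightlike_coords_involution matrix_vector_mul_assoc Lam_mult)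

lemma boost_1: "boost 1 = id"
  by (simp add: fun_eq_iff boost_def lightlike_coords_involution Lam_1)

lemma boost_e_plus: "boost m e_plus = of_int m *\<^sub>R e_plus"
proof -
  have "Lam m *v axis 1 1 = of_int m *\<^sub>R axis 1 1"
    by (simp add: vec_eq_iff forall_2 matrix_vector_mult_def sum_2 axis_def)
  moreover have "lightlike_coords (axis 1 1) = e_plus"
    using lightlike_coords_involution[of e_plus] by (simp add: lightlike_coords_e_plus)
  ultimately show ?thesis
    by (simp add: boost_def lightlike_coords_e_plus linear_cmul[OF linear_lightlike_coords])
qed

text \<open>The lightlike metric pairs each plus component with a minus component, so the factors
  \<open>m\<close> and \<open>1 / m\<close> cancel. On the lattice, index \<open>k\<close> moves to
  the integer \<open>m * k\<close>.\<close>

lemma boost_in_eG: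
  assumes "m \<noteq> 0"
  shows "boost m \<in> eG r"
proof -
  have "metric (boost m v) (boost m w) = metric v w" for v w
    using assms
    by (simp add: metric_lightlike lightlike_coords_boost matrix_vector_mult_def sum_2)
  moreover have "boost m ((of_int k * r) *\<^sub>R e_plus) = (of_int (m * k) * r) *\<^sub>R e_plus" for k
    by (simp add: linear_cmul[OF linear_boost] boost_e_plus mult_ac)
  then have "boost m ` lat r \<subseteq> lat r"
    unfolding lat_def by blast
  ultimately show ?thesis
    by (simp add: eG_def O11_def linear_boost)
qed

lemma eG_imp_boost:
  assumes "r \<noteq> 0" "L \<in> eG r"
  obtains m where "m \<noteq> 0" "L = boost m"
proof -
  define A where "A = lightlike_matrix L"
  have lin: "linear L" and met: "\<And>v w. metric (L v) (L w) = metric v w"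
    and lat: "L ` lat r \<subseteq> lat r"
    using assms(2) by (auto simp: eG_def O11_def)
  have A: "lightlike_coords (L x) = A *v lightlike_coords x" for x
    unfolding A_def by (rule lightlike_matrix_works[OF lin])
  \<comment> \<open>The generator of the lattice suffices: the index of its image is the integer
    eigenvalue.\<close>
  have "(of_int 1 * r) *\<^sub>R e_plus \<in> lat r"
    unfolding lat_def by blast
  with lat have "L (r *\<^sub>R e_plus) \<in> lat r"
    by auto
  then obtain k :: int where "L (r *\<^sub>R e_plus) = (of_int k * r) *\<^sub>R e_plus"
    by (auto simp: lat_def)
  then have "r *\<^sub>R L e_plus = r *\<^sub>R (of_int k *\<^sub>R e_plus)"
    by (simp add: linear_cmul[OF lin] mult.commute)
  then have "L e_plus = of_int k *\<^sub>R e_plus"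
    using assms(1) by (simp only: scaleR_cancel_left simp_thms)
  then have "A *v axis 1 1 = of_int k *\<^sub>R axis 1 1"
    using A[of e_plus]
    by (simp add: lightlike_coords_e_plus linear_cmul[OF linear_lightlike_coords])
  then have A11: "A $ 1 $ 1 = of_int k" and A21: "A $ 2 $ 1 = 0"
    by (simp_all add: vec_eq_iff forall_2 matrix_vector_mult_def sum_2 axis_def)
  \<comment> \<open>Every vector is the coordinate vector of some point, so metric invariance
    becomes a condition on \<open>A\<close> for arbitrary \<open>v\<close> and \<open>w\<close>,
    here with the common sign dropped.\<close>
  have form: "(A *v v) $ 1 * (A *v w) $ 2 + (A *v v) $ 2 * (A *v w) $ 1
      = v $ 1 * w $ 2 + v $ 2 * w $ 1" for v w
    using met[of "lightlike_coords v" "lightlike_coords w"]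
    by (simp add: metric_lightlike A lightlike_coords_involution)
  have A22: "of_int k * A $ 2 $ 2 = 1"
    using form[of "axis 1 1" "axis 2 1"] A11 A21
    by (simp add: matrix_vector_mult_def sum_2 axis_def)
  \<comment> \<open>The second axis is null, so pairing its image with itself gives twice this
    product equal to zero.\<close>
  have "A $ 1 $ 2 * A $ 2 $ 2 = 0"
    using form[of "axis 2 1" "axis 2 1"]
    by (simp add: matrix_vector_mult_def sum_2 axis_def)
  with A22 have A12: "A $ 1 $ 2 = 0"
    by auto
  from A22 have "k \<noteq> 0"
    by auto
  moreover have "A = Lam k"
    using A11 A21 A12 A22 \<open>k \<noteq> 0\<close> by (simp add: vec_eq_iff forall_2 field_simps)
  \<comment> \<open>A second application of \<open>lightlike_coords\<close> to both sides of
    \<open>A\<close> recovers \<open>L x\<close> itself.\<close>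
  then have "L x = boost k x" for x
    using arg_cong[OF A[of x], of lightlike_coords]
    by (simp add: boost_def lightlike_coords_involution)
  then have "L = boost k" ..
  ultimately show thesis
    using that by blast
qed

lemma eG_eq:
  assumes "r \<noteq> 0"
  shows "eG r = boost ` {m. m \<noteq> 0}"
  by (auto simp: boost_in_eG elim: eG_imp_boost[OF assms])

text \<open>The upper left entry of the lightlike matrix recovers the integer.\<close>

lemma inj_boost: "inj boost"
proof (rule injI)
  fix m m' assume "boost m = boost m'"
  then have "Lam m = Lam m'"
    by (simp flip: lightlike_matrix_boost)
  then show "m = m'"
    by simp
qed

lemma monoid_nonzero_int_monoid: "Group.monoid nonzero_int_monoid"
  by (rule monoidI) (auto simp: nonzero_int_monoid_def)

text \<open>Closure reduces to a product of nonzero integers being nonzero; the remaining laws are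
  those of function composition.\<close>

lemma monoid_eG_monoid:
  assumes "r \<noteq> 0"
  shows "Group.monoid (eG_monoid r)"
proof (rule monoidI)
  show "\<one>\<^bsub>eG_monoid r\<^esub> \<in> carrier (eG_monoid r)"
    using boost_in_eG[of 1 r] by (simp add: eG_monoid_def boost_1)
  show "L \<otimes>\<^bsub>eG_monoid r\<^esub> L' \<in> carrier (eG_monoid r)"
    if "L \<in> carrier (eG_monoid r)" "L' \<in> carrier (eG_monoid r)" for L L'
  proof -
    from that obtain m m' where "m \<noteq> 0" "L = boost m" "m' \<noteq> 0" "L' = boost m'"
      using eG_eq[OF assms] by (auto simp: eG_monoid_def)
    then show ?thesis
      using boost_in_eG[of "m * m'" r] by (simp add: eG_monoid_def boost_mult)
  qed
qed (simp_all add: eG_monoid_def comp_def)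

lemma boost_iso:
  assumes "r \<noteq> 0"
  shows "boost \<in> Group.iso nonzero_int_monoid (eG_monoid r)"
proof (rule isoI)
  show "boost \<in> hom nonzero_int_monoid (eG_monoid r)"
    by (rule homI) (simp_all add: nonzero_int_monoid_def eG_monoid_def boost_mult boost_in_eG)
  show "bij_betw boost (carrier nonzero_int_monoid) (carrier (eG_monoid r))"
    using inj_on_subset[OF inj_boost subset_UNIV]
    by (simp add: bij_betw_def nonzero_int_monoid_def eG_monoid_def eG_eq[OF assms])
qed

theorem mainTheorem2:
  fixes r :: real
  assumes "r > 0"
  shows "lightlike_matrix ` eG r = {Lam m | m :: int. m \<noteq> 0}
    \<and> Group.monoid (eG_monoid r)
    \<and> (\<forall>m m' :: int. m \<noteq> 0 \<longrightarrow> m' \<noteq> 0 \<longrightarrow> Lam m ** Lam m' = Lam (m * m'))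
    \<and> (\<forall>L\<in>eG r. \<forall>L'\<in>eG r.
          lightlike_matrix (L \<circ> L') = lightlike_matrix L ** lightlike_matrix L')
    \<and> lightlike_matrix (one (eG_monoid r)) = Lam 1
    \<and> Group.monoid nonzero_int_monoid
    \<and> (\<exists>h \<in> Group.iso nonzero_int_monoid (eG_monoid r).
          h (one nonzero_int_monoid) = one (eG_monoid r)
          \<and> (\<forall>m :: int. m \<noteq> 0 \<longrightarrow> lightlike_matrix (h m) = Lam m))"
proof -
  have r: "r \<noteq> 0"
    using assms by simp
  have 1: "lightlike_matrix ` eG r = {Lam m | m :: int. m \<noteq> 0}"
    unfolding eG_eq[OF r] image_image lightlike_matrix_boost by (rule image_Collect)
  have 2: "\<forall>L\<in>eG r. \<forall>L'\<in>eG r.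
      lightlike_matrix (L \<circ> L') = lightlike_matrix L ** lightlike_matrix L'"
    by (simp add: eG_def O11_def lightlike_matrix_compose)
  have 3: "lightlike_matrix (one (eG_monoid r)) = Lam 1"
    by (simp add: eG_monoid_def lightlike_matrix_id Lam_1)
  have 4: "boost (one nonzero_int_monoid) = one (eG_monoid r)"
    by (simp add: nonzero_int_monoid_def eG_monoid_def boost_1)
  have 5: "\<forall>m. m \<noteq> 0 \<longrightarrow> lightlike_matrix (boost m) = Lam m"
    by (simp add: lightlike_matrix_boost)
  have 6: "\<forall>m m'. m \<noteq> 0 \<longrightarrow> m' \<noteq> 0 \<longrightarrow> Lam m ** Lam m' = Lam (m * m')"
    by (simp add: Lam_mult)
  show ?thesis
    \<comment> \<open>The witness for the isomorphism is \<open>boost\<close>, which sends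
      \<open>1\<close> to the identity and \<open>m\<close> to a map with matrix
      \<open>Lam m\<close>.\<close>
    by (intro conjI bexI[OF _ boost_iso[OF r]] 1 2 3 4 5 6
        monoid_eG_monoid[OF r] monoid_nonzero_int_monoid)
qed

end
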